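(* Assume $MA_{\omega_1}$. Let $\chi=(\omega_1,c)$ be a rectangular model, where $c:\omega_1\times\omega_1\to K$ for a countable set $K$. Then $c$ is a countable union of rectangles: there are countably many pairs $(I_n,J_n)$ of subsets of $\omega_1$ such that $c$ is constant on each $I_n\times J_n$ and $\bigcup_n I_n\times J_n=\{(\alpha,\beta)\in\omega_1\times\omega_1:\alpha\neq\beta\}$.
   Context: The model is viewed as having a single "relation" given by the coloring $c$ of ordered pairs (e.g. $c(x,y)$ is the quantifier-free type of $(x,y)$ in a structure in a countable binary relational language). Tuples $\bar x,\bar y\in\omega_1^n$ with disjoint entry sets are alike if: $c(x_i,y_i)=c(x_j,y_j)$ and $c(y_i,x_i)=c(y_j,x_j)$ for all $i,j$; $c(x_i,x_j)=c(y_i,y_j)$ for all $i,j$; and for all $i,j$ with $x_i\neq x_j$, $c(x_i,x_j)=c(x_i,y_j)=c(y_i,x_j)$. $\chi$ is rectangular if for every $n$ and every family of $\omega_1$ many $n$-tuples with pairwise disjoint entry sets, two distinct members are alike. A rectangle is a set of the form $I\times J$ with $I,J\subseteq\omega_1$. *)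

theory Defs
  imports Complex_Main "HOL-Library.Equipollence"
begin

text \<open>The type \<open>nat suc\<close> of Main is a copy of the field of the successor cardinal of
  \<open>|UNIV :: nat set|\<close>, that is, of \<open>\<omega>\<^sub>1\<close>; its initial well-order is \<open>card_suc natLeq\<close>.\<close>

type_synonym omega1 = "nat suc"

lemma card_of_omega1: "(card_of (UNIV :: omega1 set), cardSuc natLeq) \<in> ordIso"
  by (meson card_of_unique card_order_card_suc cardSuc_ordIso_card_suc natLeq_card_order
      ordIso_symmetric ordIso_transitive)

text \<open>Forcing convention: \<open>(p, q) \<in> le\<close> means that \<open>p\<close> is the stronger condition.\<close>

definition compatible :: "'p set \<Rightarrow> 'p rel \<Rightarrow> 'p \<Rightarrow> 'p \<Rightarrow> bool" where
  "compatible P le p q \<longleftrightarrow> (\<exists>s\<in>P. (s, p) \<in> le \<and> (s, q) \<in> le)"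

definition ccc :: "'p set \<Rightarrow> 'p rel \<Rightarrow> bool" where
  "ccc P le \<longleftrightarrow>
     (\<forall>A\<subseteq>P. pairwise (\<lambda>p q. \<not> compatible P le p q) A \<longrightarrow> countable A)"

definition dense_in :: "'p set \<Rightarrow> 'p rel \<Rightarrow> 'p set \<Rightarrow> bool" where
  "dense_in P le D \<longleftrightarrow> D \<subseteq> P \<and> (\<forall>p\<in>P. \<exists>d\<in>D. (d, p) \<in> le)"

definition filter_in :: "'p set \<Rightarrow> 'p rel \<Rightarrow> 'p set \<Rightarrow> bool" where
  "filter_in P le G \<longleftrightarrow>
     G \<noteq> {} \<and> G \<subseteq> P \<and>
     (\<forall>p\<in>G. \<forall>q\<in>P. (p, q) \<in> le \<longrightarrow> q \<in> G) \<and>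
     (\<forall>p\<in>G. \<forall>q\<in>G. \<exists>s\<in>G. (s, p) \<in> le \<and> (s, q) \<in> le)"

text \<open>Martin's axiom for \<open>\<omega>\<^sub>1\<close> many dense sets. A HOL formula cannot quantify over types, so the
  posets range over all partially ordered subsets of a type \<open>'p\<close>, which is a parameter. If \<open>'p\<close>
  is at least as large as \<open>\<omega>\<^sub>1\<close>, this follows from the unrestricted axiom, and it is equivalent
  to it by the usual reduction to posets of size at most \<open>\<omega>\<^sub>1\<close>; for countable \<open>'p\<close> it is
  provable and would be useless as an assumption.\<close>

definition MA_omega1 :: "'p itself \<Rightarrow> bool" where
  "MA_omega1 (_ :: 'p itself) \<longleftrightarrow>
     (\<forall>(P :: 'p set) le \<D>.
        P \<noteq> {} \<and> partial_order_on P le \<and> ccc P le \<and>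
        \<D> \<lesssim> (UNIV :: omega1 set) \<and> (\<forall>D\<in>\<D>. dense_in P le D)
        \<longrightarrow> (\<exists>G. filter_in P le G \<and> (\<forall>D\<in>\<D>. G \<inter> D \<noteq> {})))"

text \<open>An \<open>n\<close>-tuple is a list of length \<open>n\<close>, so its entry set is \<open>set xs\<close>.\<close>

definition alike :: "('a \<Rightarrow> 'a \<Rightarrow> 'k) \<Rightarrow> 'a list \<Rightarrow> 'a list \<Rightarrow> bool" where
  "alike c xs ys \<longleftrightarrow>
     length xs = length ys \<and> set xs \<inter> set ys = {} \<and>
     (\<forall>i<length xs. \<forall>j<length xs.
        c (xs ! i) (ys ! i) = c (xs ! j) (ys ! j) \<and>
        c (ys ! i) (xs ! i) = c (ys ! j) (xs ! j)) \<and>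
     (\<forall>i<length xs. \<forall>j<length xs. c (xs ! i) (xs ! j) = c (ys ! i) (ys ! j)) \<and>
     (\<forall>i<length xs. \<forall>j<length xs. xs ! i \<noteq> xs ! j \<longrightarrow>
        c (xs ! i) (xs ! j) = c (xs ! i) (ys ! j) \<and>
        c (xs ! i) (ys ! j) = c (ys ! i) (xs ! j))"

text \<open>A family of \<open>\<omega>\<^sub>1\<close> many tuples is given by its set of members. For \<open>n \<ge> 1\<close> nothing is lost,
  as tuples with disjoint nonempty entry sets are distinct; for \<open>n = 0\<close> the condition is vacuous.\<close>

definition rectangular :: "(omega1 \<Rightarrow> omega1 \<Rightarrow> 'k) \<Rightarrow> bool" where
  "rectangular c \<longleftrightarrow>
     (\<forall>n. \<forall>F :: omega1 list set.
        (\<forall>xs\<in>F. length xs = n) \<and> F \<approx> (UNIV :: omega1 set) \<and>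
        pairwise (\<lambda>xs ys. set xs \<inter> set ys = {}) F
        \<longrightarrow> (\<exists>xs\<in>F. \<exists>ys\<in>F. xs \<noteq> ys \<and> alike c xs ys))"

end

theory Submission
  imports Defs "HOL-Library.Countable_Set_Type" "HOL-Algebra.Free_Abelian_Groups"
begin

text \<open>Force with finite approximations to a sequence of rectangles, each with a prescribed colour;
  meeting one dense set for each pair \<open>\<alpha> \<noteq> \<beta>\<close> makes the generic rectangles cover the complement
  of the diagonal. For the countable chain condition, thin an uncountable set of conditions to a
  \<open>\<Delta>\<close>-system in which all conditions agree on the root and label corresponding points outside it in
  the same way. By rectangularity two of the tuples outside the root are alike, and the union of
  their conditions is a condition: a new pair \<open>(x\<^sub>i, y\<^sub>j)\<close> has the colour of \<open>(x\<^sub>i, x\<^sub>j)\<close>, and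
  \<open>i \<noteq> j\<close> since no point lies on both sides of one rectangle.\<close>

section \<open>Pigeonhole and Delta-systems\<close>

lemma uncountable_fibre:
  assumes "uncountable A" and "countable (f ` A)"
  obtains y where "uncountable {a \<in> A. f a = y}"
proof -
  have "A = (\<Union>y\<in>f ` A. {a \<in> A. f a = y})" by blast
  then show ?thesis
    using assms that by (metis (no_types, lifting) countable_UN)
qed

text \<open>Induction on \<open>n\<close>. If one point lies in uncountably many of the sets, delete
  it, apply the induction hypothesis and return it to the root. Otherwise every point lies in only
  countably many of them, and a maximal pairwise disjoint subfamily is already uncountable, with
  empty root. The family is indexed by \<open>A\<close> and \<open>pairwise\<close> compares
  indices, so \<open>f\<close> need not be injective.\<close>

lemma delta_system_card:
  assumes "uncountable A" and "\<And>a. a \<in> A \<Longrightarrow> finite (f a) \<and> card (f a) = n"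
  shows "\<exists>R B. B \<subseteq> A \<and> uncountable B \<and> pairwise (\<lambda>a b. f a \<inter> f b = R) B"
  using assms
proof (induction n arbitrary: A f)
  case 0
  then have "f a = {}" if "a \<in> A" for a
    using that by (metis card_0_eq)
  then have "pairwise (\<lambda>a b. f a \<inter> f b = {}) A"
    by (simp add: pairwise_def)
  with 0 show ?case by blast
next
  case (Suc n)
  show ?case
  proof (cases "\<exists>x. uncountable {a \<in> A. x \<in> f a}")
    case True
    then obtain x where x: "uncountable {a \<in> A. x \<in> f a}" by blast
    have "\<exists>R B. B \<subseteq> {a \<in> A. x \<in> f a} \<and> uncountable B \<and>
        pairwise (\<lambda>a b. (f a - {x}) \<inter> (f b - {x}) = R) B"
    proof (rule Suc.IH[OF x])
      fix a assume "a \<in> {a \<in> A. x \<in> f a}"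
      then show "finite (f a - {x}) \<and> card (f a - {x}) = n"
        using Suc.prems(2)[of a] by auto
    qed
    then obtain R B where
      B: "B \<subseteq> {a \<in> A. x \<in> f a}" "uncountable B"
        "pairwise (\<lambda>a b. (f a - {x}) \<inter> (f b - {x}) = R) B"
      by (elim exE conjE)
    have "pairwise (\<lambda>a b. f a \<inter> f b = insert x R) B"
    proof (rule pairwiseI)
      fix a b assume ab: "a \<in> B" "b \<in> B" "a \<noteq> b"
      then have "(f a - {x}) \<inter> (f b - {x}) = R"
        using B(3) by (simp add: pairwise_def)
      moreover have "x \<in> f a" "x \<in> f b"
        using ab B(1) by blast+
      ultimately show "f a \<inter> f b = insert x R" by blast
    qed
    moreover have "B \<subseteq> A" using B(1) by blast
    ultimately show ?thesis using B(2) by (intro exI[of _ "insert x R"] exI[of _ B] conjI)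
  next
    case False
    let ?S = "{B. B \<subseteq> A \<and> pairwise (\<lambda>a b. f a \<inter> f b = {}) B}"
    have "\<exists>M\<in>?S. \<forall>X\<in>?S. M \<subseteq> X \<longrightarrow> X = M"
    proof (rule subset_Zorn')
      fix C assume C: "subset.chain ?S C"
      then have "C \<subseteq> ?S" by (simp add: subset.chain_def)
      moreover have "pairwise (\<lambda>a b. f a \<inter> f b = {}) (\<Union>C)"
      proof (rule pairwise_chain_Union)
        show "pairwise (\<lambda>a b. f a \<inter> f b = {}) S" if "S \<in> C" for S
          using that \<open>C \<subseteq> ?S\<close> by blast
        show "chain\<^sub>\<subseteq> C"
          using C unfolding subset_chain_def chain_subset_def by blast
      qed
      ultimately show "\<Union>C \<in> ?S" by blast
    qed
    then obtain M where M: "M \<in> ?S" and max: "\<forall>X\<in>?S. M \<subseteq> X \<longrightarrow> X = M" ..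
    from M have M: "M \<subseteq> A" "pairwise (\<lambda>a b. f a \<inter> f b = {}) M"
      by simp_all
    have "uncountable M"
    proof
      assume cM: "countable M"
      have "countable (\<Union>a\<in>M. f a)"
        using cM M(1) Suc.prems(2) by (blast intro: countable_UN countable_finite)
      \<comment> \<open>\<open>M\<close> hits countably many points, and each of them lies in
        \<open>f a\<close> for only countably many \<open>a\<close>. So an \<open>a\<close> outside
        \<open>?N\<close> is new and \<open>f a\<close> misses every \<open>f b\<close> with
        \<open>b\<close> in \<open>M\<close>, against maximality.\<close>
      then have "countable (M \<union> (\<Union>x\<in>(\<Union>a\<in>M. f a). {a \<in> A. x \<in> f a}))" (is "countable ?N")
        using False cM by blast
      then have "\<not> A \<subseteq> ?N"
        using Suc.prems(1) countable_subset by blast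
      then obtain a where a: "a \<in> A" "a \<notin> ?N" by blast
      then have "f a \<inter> f b = {}" if "b \<in> M" for b
        using that by blast
      then have "pairwise (\<lambda>a b. f a \<inter> f b = {}) (insert a M)"
        using M(2) by (simp add: pairwise_insert Int_commute)
      then have "insert a M \<in> ?S"
        using a(1) M(1) by simp
      then have "insert a M = M"
        by (rule max[rule_format]) auto
      then have "a \<in> M" by blast
      with a(2) show False by blast
    qed
    with M show ?thesis by (intro exI[of _ "{}"] exI[of _ M] conjI)
  qed
qed

text \<open>Cardinalities of finite sets take countably many values, so one of them occurs
  uncountably often and the uniform case applies.\<close>

lemma delta_system:
  assumes "uncountable A" and "\<And>a. a \<in> A \<Longrightarrow> finite (f a)"
  obtains R B where "B \<subseteq> A" and "uncountable B" and "pairwise (\<lambda>a b. f a \<inter> f b = R) B"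
proof -
  obtain n where n: "uncountable {a \<in> A. card (f a) = n}"
    using uncountable_fibre[OF assms(1), of "\<lambda>a. card (f a)"] by blast
  have "\<exists>R B. B \<subseteq> {a \<in> A. card (f a) = n} \<and> uncountable B \<and> pairwise (\<lambda>a b. f a \<inter> f b = R) B"
    by (rule delta_system_card[OF n, of f n]) (use assms(2) in auto)
  with that show ?thesis by blast
qed

section \<open>Cardinal arithmetic at omega_1\<close>

text \<open>An uncountable cardinal lies strictly above \<open>natLeq\<close>, hence is at least its
  successor cardinal, which is the size of \<open>omega1\<close>.\<close>

lemma omega1_lepoll_uncountable:
  assumes "uncountable A"
  shows "(UNIV :: omega1 set) \<lesssim> A"
proof -
  have "\<not> |A| \<le>o natLeq"
    using assms countable_card_le_natLeq by blast
  then have "natLeq <o |A|"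
    by (simp add: natLeq_Well_order not_ordLeq_iff_ordLess)
  then have "cardSuc natLeq \<le>o |A|"
    by (intro cardSuc_least) (auto simp: natLeq_Card_order)
  then have "|UNIV :: omega1 set| \<le>o |A|"
    using card_of_omega1 ordIso_ordLeq_trans by blast
  then show ?thesis
    by (simp add: lepoll_def card_of_ordLeq[symmetric])
qed

lemma infinite_omega1: "infinite (UNIV :: omega1 set)"
proof
  assume "finite (UNIV :: omega1 set)"
  then have "|UNIV :: omega1 set| <o natLeq"
    using finite_iff_ordLess_natLeq by blast
  then have "cardSuc natLeq <o natLeq"
    using card_of_omega1 ordIso_ordLess_trans ordIso_symmetric by blast
  then show False
    using cardSuc_greater[OF natLeq_Card_order] not_ordLess_ordLeq ordLess_imp_ordLeq by blast
qed

lemma omega1_times_omega1_lepoll: "(UNIV :: (omega1 \<times> omega1) set) \<lesssim> (UNIV :: omega1 set)"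
proof -
  have "|(UNIV :: omega1 set) \<times> (UNIV :: omega1 set)| =o |UNIV :: omega1 set|"
    by (rule card_of_Times_same_infinite[OF infinite_omega1])
  then show ?thesis
    unfolding lepoll_def card_of_ordLeq by (simp add: ordIso_imp_ordLeq)
qed

text \<open>This bounds the size of the forcing: with countably many labels there are at most
  aleph_1 labelled points, and an infinite set has as many finite subsets as elements.\<close>

lemma finite_labelled_subsets_lepoll_omega1:
  "{p :: ('l :: countable \<times> omega1) set. finite p} \<lesssim> (UNIV :: omega1 set)"
proof -
  have "|UNIV :: 'l set| \<le>o |UNIV :: omega1 set|"
    using infinite_omega1
    by (meson countable_card_le_natLeq countableI_type infinite_iff_natLeq_ordLeq ordLeq_transitive)
  then have "|(UNIV :: 'l set) \<times> (UNIV :: omega1 set)| \<le>o |UNIV :: omega1 set|"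
    using card_of_Times_infinite_simps(3)[OF infinite_omega1, of "UNIV :: 'l set"]
    by (cases "(UNIV :: 'l set) = {}") (auto intro: ordIso_imp_ordLeq)
  then have le: "|UNIV :: ('l \<times> omega1) set| \<le>o |UNIV :: omega1 set|"
    by simp
  have "infinite (UNIV :: ('l \<times> omega1) set)"
    using infinite_omega1 by (simp add: finite_prod)
  then have "Fpow (UNIV :: ('l \<times> omega1) set) \<approx> (UNIV :: ('l \<times> omega1) set)"
    by (rule eqpoll_Fpow)
  moreover have "(UNIV :: ('l \<times> omega1) set) \<lesssim> (UNIV :: omega1 set)"
    using le by (simp add: lepoll_def card_of_ordLeq[symmetric])
  ultimately have "Fpow (UNIV :: ('l \<times> omega1) set) \<lesssim> (UNIV :: omega1 set)"
    by (meson eqpoll_imp_lepoll lepoll_trans)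
  then show ?thesis
    by (simp add: Fpow_def)
qed

section \<open>Martin's axiom for posets on other types\<close>

text \<open>\<open>MA_omega1\<close> speaks only of posets inside the type \<open>'p\<close>. A
  poset of size at most aleph_1 embeds there: copy the order and the dense sets along an injection,
  and pull the generic filter back.\<close>

lemma MA_omega1_transfer:
  fixes P :: "'a set" and le :: "'a rel"
  assumes size: "(UNIV :: omega1 set) \<lesssim> (UNIV :: 'p set)" and MA: "MA_omega1 TYPE('p)"
    and P: "P \<lesssim> (UNIV :: omega1 set)" "P \<noteq> {}" "partial_order_on P le" "ccc P le"
    and D: "\<D> \<lesssim> (UNIV :: omega1 set)" "\<And>D. D \<in> \<D> \<Longrightarrow> dense_in P le D"
  obtains G where "filter_in P le G" and "\<And>D. D \<in> \<D> \<Longrightarrow> G \<inter> D \<noteq> {}"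
proof -
  have "P \<lesssim> (UNIV :: 'p set)"
    using P(1) size by (rule lepoll_trans)
  then obtain h :: "'a \<Rightarrow> 'p" where h: "inj_on h P"
    by (auto simp: lepoll_def)
  have leP: "x \<in> P \<and> y \<in> P" if "(x, y) \<in> le" for x y
    using that P(3) by (auto simp: partial_order_on_def preorder_on_def refl_on_def)
  define Q where "Q = h ` P"
  define leQ where "leQ = map_prod h h ` le"
  \<comment> \<open>\<open>h\<close> is injective on \<open>P\<close> only, so reflecting the order
    uses that \<open>le\<close> relates only elements of \<open>P\<close>.\<close>
  have leQ: "(h x, h y) \<in> leQ \<longleftrightarrow> (x, y) \<in> le" if "x \<in> P" "y \<in> P" for x y
  proof
    assume "(h x, h y) \<in> leQ"
    then obtain a b where ab: "(a, b) \<in> le" "h x = h a" "h y = h b"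
      by (auto simp: leQ_def)
    with leP[OF ab(1)] that h show "(x, y) \<in> le"
      by (metis inj_onD)
  qed (force simp: leQ_def)
  have "leQ \<subseteq> Q \<times> Q"
    using leP by (auto simp: Q_def leQ_def)
  have po: "refl_on P le" "trans le" "antisym le" "le \<subseteq> P \<times> P"
    using P(3) leP by (auto simp: partial_order_on_def preorder_on_def)
  have "partial_order_on Q leQ"
    unfolding partial_order_on_def preorder_on_def
  proof (intro conjI)
    show "leQ \<subseteq> Q \<times> Q" by fact
    show "refl_on Q leQ"
      using po(1) leQ \<open>leQ \<subseteq> Q \<times> Q\<close> by (auto simp: refl_on_def Q_def)
    show "trans leQ"
    proof (rule transI)
      fix x y z assume xy: "(x, y) \<in> leQ" and yz: "(y, z) \<in> leQ"
      then obtain a b d where "x = h a" "y = h b" "z = h d" "a \<in> P" "b \<in> P" "d \<in> P"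
        using \<open>leQ \<subseteq> Q \<times> Q\<close> unfolding Q_def by blast
      with xy yz show "(x, z) \<in> leQ"
        using leQ po(2) by (metis transD)
    qed
    show "antisym leQ"
    proof (rule antisymI)
      fix x y assume xy: "(x, y) \<in> leQ" and yx: "(y, x) \<in> leQ"
      then obtain a b where "x = h a" "y = h b" "a \<in> P" "b \<in> P"
        using \<open>leQ \<subseteq> Q \<times> Q\<close> unfolding Q_def by blast
      with xy yx show "x = y"
        using leQ po(3) by (metis antisymD)
    qed
  qed
  moreover have "ccc Q leQ"
    unfolding ccc_def
  proof (intro allI impI)
    fix A assume "A \<subseteq> Q" and pw: "pairwise (\<lambda>p q. \<not> compatible Q leQ p q) A"
    then obtain B where B: "B \<subseteq> P" "A = h ` B"
      unfolding Q_def by (meson subset_imageE)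
    have "pairwise (\<lambda>p q. \<not> compatible P le p q) B"
    proof (rule pairwiseI, rule notI)
      fix x y assume xy: "x \<in> B" "y \<in> B" "x \<noteq> y" "compatible P le x y"
      then have "h x \<noteq> h y"
        using B h by (meson inj_onD subsetD)
      moreover have "compatible Q leQ (h x) (h y)"
        using xy B(1) leQ unfolding compatible_def Q_def by blast
      ultimately show False
        using pw xy B(2) by (auto simp: pairwise_def)
    qed
    then have "countable B"
      using P(4) B(1) unfolding ccc_def by blast
    then show "countable A"
      using B(2) by simp
  qed
  moreover have "(\<lambda>D. h ` D) ` \<D> \<lesssim> (UNIV :: omega1 set)"
    using image_lepoll D(1) by (rule lepoll_trans)
  moreover have "dense_in Q leQ D'" if D'_in: "D' \<in> (\<lambda>D. h ` D) ` \<D>" for D'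
  proof -
    obtain D where D': "D \<in> \<D>" "D' = h ` D" using D'_in by blast
    then have "D \<subseteq> P" "\<forall>p\<in>P. \<exists>d\<in>D. (d, p) \<in> le"
      using D(2) by (auto simp: dense_in_def)
    then show ?thesis
      using leQ unfolding dense_in_def D'(2) Q_def by blast
  qed
  moreover have "Q \<noteq> {}"
    using P(2) by (simp add: Q_def)
  ultimately obtain G' where G': "filter_in Q leQ G'" "\<And>D. D \<in> \<D> \<Longrightarrow> G' \<inter> h ` D \<noteq> {}"
    using MA unfolding MA_omega1_def by (metis imageI)
  \<comment> \<open>Every element of \<open>G'\<close> has a preimage in \<open>P\<close>, so
    \<open>h\<close> maps \<open>G\<close> onto \<open>G'\<close> and common extensions can be
    pulled back.\<close>
  define G where "G = {x \<in> P. h x \<in> G'}"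
  have G'eq: "G' = h ` G"
    using G'(1) by (auto simp: G_def filter_in_def Q_def)
  have "filter_in P le G"
    unfolding filter_in_def
  proof (intro conjI ballI impI)
    show "G \<noteq> {}"
      using G'(1) G'eq by (auto simp: filter_in_def)
    show "G \<subseteq> P" by (auto simp: G_def)
    show "q \<in> G" if "p \<in> G" "q \<in> P" "(p, q) \<in> le" for p q
      using that G'(1) leQ unfolding G_def filter_in_def Q_def by blast
    show "\<exists>s\<in>G. (s, p) \<in> le \<and> (s, q) \<in> le" if "p \<in> G" "q \<in> G" for p q
    proof -
      have "\<exists>s\<in>G'. (s, h p) \<in> leQ \<and> (s, h q) \<in> leQ"
        using that G'(1) unfolding G_def filter_in_def by blast
      then obtain s where s: "s \<in> G" "(h s, h p) \<in> leQ" "(h s, h q) \<in> leQ"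
        unfolding G'eq by blast
      then have "(s, p) \<in> le" "(s, q) \<in> le"
        using that by (auto simp: G_def leQ)
      with s(1) show ?thesis by blast
    qed
  qed
  moreover have "G \<inter> D \<noteq> {}" if "D \<in> \<D>" for D
  proof -
    obtain d where d: "d \<in> D" "h d \<in> G'"
      using G'(2)[OF \<open>D \<in> \<D>\<close>] by blast
    moreover have "d \<in> P"
      using d(1) D(2)[OF that] by (auto simp: dense_in_def)
    ultimately show ?thesis by (auto simp: G_def)
  qed
  ultimately show ?thesis by (rule that)
qed

section \<open>The forcing with finite approximations to rectangles\<close>

text \<open>A condition is a finite set of labelled points; the label \<open>(k, m, True)\<close> puts the point
  into the first side of the \<open>m\<close>-th rectangle of colour \<open>k\<close>, the label \<open>(k, m, False)\<close> into the
  second side.\<close>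

definition rect_conditions ::
    "(omega1 \<Rightarrow> omega1 \<Rightarrow> nat) \<Rightarrow> ((nat \<times> nat \<times> bool) \<times> omega1) set set" where
  "rect_conditions c = {p. finite p \<and>
     (\<forall>k m \<alpha> \<beta>. ((k, m, True), \<alpha>) \<in> p \<longrightarrow> ((k, m, False), \<beta>) \<in> p \<longrightarrow> \<alpha> \<noteq> \<beta> \<and> c \<alpha> \<beta> = k)}"

text \<open>Reverse inclusion: a condition with more labelled points says more about the rectangles
  and is stronger.\<close>

definition ext_order :: "'a set set \<Rightarrow> 'a set rel" where
  "ext_order P = {(p, q). p \<in> P \<and> q \<in> P \<and> q \<subseteq> p}"

lemma partial_order_on_ext_order: "partial_order_on P (ext_order P)"
  unfolding partial_order_on_def preorder_on_def ext_order_def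
  by (intro conjI refl_onI transI antisymI) auto

section \<open>Rectangularity and the countable chain condition\<close>

text \<open>\<open>rectangular\<close> speaks of families of size exactly aleph_1; an uncountable
  family contains an injective image of \<open>omega1\<close>, and that subfamily supplies the
  pair.\<close>

lemma rectangular_uncountable:
  assumes "rectangular c" and "uncountable F" and "\<And>xs. xs \<in> F \<Longrightarrow> length xs = n"
    and "pairwise (\<lambda>xs ys. set xs \<inter> set ys = {}) F"
  obtains xs ys where "xs \<in> F" and "ys \<in> F" and "xs \<noteq> ys" and "alike c xs ys"
proof -
  obtain g :: "omega1 \<Rightarrow> omega1 list" where g: "inj g" "range g \<subseteq> F"
    using omega1_lepoll_uncountable[OF assms(2)] by (auto simp: lepoll_def)
  have "range g \<approx> (UNIV :: omega1 set)"
    using g(1) by (simp add: inj_on_image_eqpoll_self)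
  moreover have "pairwise (\<lambda>xs ys. set xs \<inter> set ys = {}) (range g)"
    using assms(4) g(2) by (rule pairwise_subset)
  moreover have "\<forall>xs\<in>range g. length xs = n"
    using assms(3) g(2) by blast
  ultimately have "\<exists>xs\<in>range g. \<exists>ys\<in>range g. xs \<noteq> ys \<and> alike c xs ys"
    using assms(1) unfolding rectangular_def by blast
  with g(2) that show ?thesis by blast
qed

text \<open>\<open>alike\<close> asserts only equalities between colours, and these survive any
  recoding \<open>f\<close>. This allows colours to be replaced by natural numbers.\<close>

lemma rectangular_comp:
  assumes "rectangular c"
  shows "rectangular (\<lambda>\<alpha> \<beta>. f (c \<alpha> \<beta>))"
proof -
  have "alike (\<lambda>\<alpha> \<beta>. f (c \<alpha> \<beta>)) xs ys" if "alike c xs ys" for xs ys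
    using that unfolding alike_def by metis
  with assms show ?thesis
    unfolding rectangular_def by meson
qed

text \<open>Only pairs with one point from each condition need care. If either point is in
  \<open>R\<close>, its labels are the same in \<open>p\<close> and \<open>q\<close>, so both
  labelled points lie in one condition. Otherwise the point from \<open>q\<close> is exchanged for
  its counterpart in \<open>p\<close>, where the colour is known, and \<open>alike\<close> carries
  the colour back.\<close>

lemma rect_conditions_Un:
  assumes p: "p \<in> rect_conditions c" and q: "q \<in> rect_conditions c"
    and setx: "set xs = snd ` p - R" and sety: "set ys = snd ` q - R"
    and types: "map (\<lambda>\<alpha>. {l. (l, \<alpha>) \<in> p}) xs = map (\<lambda>\<alpha>. {l. (l, \<alpha>) \<in> q}) ys"
    and root: "{u \<in> p. snd u \<in> R} = {u \<in> q. snd u \<in> R}"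
    and alike: "alike c xs ys"
  shows "p \<union> q \<in> rect_conditions c"
proof -
  have len: "length ys = length xs"
    using types by (metis length_map)
  have type_iff: "(l, xs ! i) \<in> p \<longleftrightarrow> (l, ys ! i) \<in> q" if "i < length xs" for l i
  proof -
    have "map (\<lambda>\<alpha>. {l. (l, \<alpha>) \<in> p}) xs ! i = map (\<lambda>\<alpha>. {l. (l, \<alpha>) \<in> q}) ys ! i"
      by (simp only: types)
    with that len show ?thesis by auto
  qed
  have good_p: "\<alpha> \<noteq> \<beta> \<and> c \<alpha> \<beta> = k"
    if "((k, m, True), \<alpha>) \<in> p" "((k, m, False), \<beta>) \<in> p" for k m \<alpha> \<beta>
    using p that by (auto simp: rect_conditions_def)
  have good_q: "\<alpha> \<noteq> \<beta> \<and> c \<alpha> \<beta> = k"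
    if "((k, m, True), \<alpha>) \<in> q" "((k, m, False), \<beta>) \<in> q" for k m \<alpha> \<beta>
    using q that by (auto simp: rect_conditions_def)
  have root_iff: "(l, \<alpha>) \<in> p \<longleftrightarrow> (l, \<alpha>) \<in> q" if "\<alpha> \<in> R" for l \<alpha>
  proof -
    have "(l, \<alpha>) \<in> {u \<in> p. snd u \<in> R} \<longleftrightarrow> (l, \<alpha>) \<in> {u \<in> q. snd u \<in> R}"
      by (simp only: root)
    with that show ?thesis by simp
  qed
  have idx_p: "\<exists>i<length xs. \<alpha> = xs ! i" if "(l, \<alpha>) \<in> p" "\<alpha> \<notin> R" for l \<alpha>
  proof -
    have "\<alpha> \<in> set xs"
      using that setx by force
    then show ?thesis by (auto simp: in_set_conv_nth)
  qed
  have idx_q: "\<exists>i<length xs. \<alpha> = ys ! i" if "(l, \<alpha>) \<in> q" "\<alpha> \<notin> R" for l \<alpha>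
  proof -
    have "\<alpha> \<in> set ys"
      using that sety by force
    then show ?thesis using len by (auto simp: in_set_conv_nth)
  qed
  have disj: "xs ! i \<noteq> ys ! j" if "i < length xs" "j < length xs" for i j
    using alike that len unfolding alike_def by (metis disjoint_iff nth_mem)
  have cross: "c (xs ! i) (ys ! j) = c (xs ! i) (xs ! j) \<and> c (ys ! i) (xs ! j) = c (xs ! i) (xs ! j)"
    if "i < length xs" "j < length xs" "xs ! i \<noteq> xs ! j" for i j
  proof -
    have "\<forall>i<length xs. \<forall>j<length xs. xs ! i \<noteq> xs ! j \<longrightarrow>
        c (xs ! i) (xs ! j) = c (xs ! i) (ys ! j) \<and> c (xs ! i) (ys ! j) = c (ys ! i) (xs ! j)"
      using alike unfolding alike_def by (elim conjE)
    with that show ?thesis by simp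
  qed
  have pq: "\<alpha> \<noteq> \<beta> \<and> c \<alpha> \<beta> = k"
    if u: "((k, m, True), \<alpha>) \<in> p" and v: "((k, m, False), \<beta>) \<in> q" for k m \<alpha> \<beta>
  proof (cases "\<alpha> \<in> R \<or> \<beta> \<in> R")
    case True
    then show ?thesis
      using u v root_iff good_p good_q by blast
  next
    case False
    then obtain i j where ij: "i < length xs" "\<alpha> = xs ! i" "j < length xs" "\<beta> = ys ! j"
      using idx_p u idx_q v by blast
    \<comment> \<open>The label of \<open>ys ! j\<close> in \<open>q\<close> is also a label of
      \<open>xs ! j\<close> in \<open>p\<close>. As \<open>p\<close> is a condition, this yields
      both the colour and the inequality of entries that \<open>cross\<close> requires.\<close>
    then have "xs ! i \<noteq> xs ! j \<and> c (xs ! i) (xs ! j) = k"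
      using u v type_iff good_p by blast
    then show ?thesis
      using ij cross disj by metis
  qed
  have qp: "\<alpha> \<noteq> \<beta> \<and> c \<alpha> \<beta> = k"
    if u: "((k, m, True), \<alpha>) \<in> q" and v: "((k, m, False), \<beta>) \<in> p" for k m \<alpha> \<beta>
  proof (cases "\<alpha> \<in> R \<or> \<beta> \<in> R")
    case True
    then show ?thesis
      using u v root_iff good_p good_q by blast
  next
    case False
    then obtain i j where ij: "i < length xs" "\<alpha> = ys ! i" "j < length xs" "\<beta> = xs ! j"
      using idx_q u idx_p v by blast
    then have "xs ! i \<noteq> xs ! j \<and> c (xs ! i) (xs ! j) = k"
      using u v type_iff good_p by blast
    then show ?thesis
      using ij cross disj by metis
  qed
  have "finite (p \<union> q)"
    using p q by (simp add: rect_conditions_def)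
  then show ?thesis
    unfolding rect_conditions_def using good_p good_q pq qp by blast
qed

lemma ccc_rect_conditions:
  assumes rect: "rectangular c"
  shows "ccc (rect_conditions c) (ext_order (rect_conditions c))"
  unfolding ccc_def
proof (intro allI impI, rule ccontr)
  let ?P = "rect_conditions c"
  fix A assume A: "A \<subseteq> ?P" and incomp: "pairwise (\<lambda>p q. \<not> compatible ?P (ext_order ?P) p q) A"
    and "uncountable A"
  have fin: "finite p" if "p \<in> A" for p
    using that A by (auto simp: rect_conditions_def)
  have fin_dom: "finite (snd ` p)" if "p \<in> A" for p
    using fin[OF that] by blast
  obtain R B where B: "B \<subseteq> A" "uncountable B" "pairwise (\<lambda>p q. snd ` p \<inter> snd ` q = R) B"
    by (rule delta_system[OF \<open>uncountable A\<close>, of "\<lambda>p. snd ` p"]) (use fin_dom in simp_all)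
  \<comment> \<open>\<open>R\<close> is the intersection of the domains of two distinct members of
    \<open>B\<close>. Its finiteness makes the possible traces on the root countable in
    number.\<close>
  have "finite R"
  proof -
    obtain p where p: "p \<in> B" using B(2) by fastforce
    have "uncountable (B - {p})" using B(2) by (simp add: uncountable_minus_countable)
    then obtain q where "q \<in> B" "q \<noteq> p"
      by (metis Diff_iff all_not_in_conv countable_empty singletonI)
    with p B(3) have "R = snd ` p \<inter> snd ` q" by (simp add: pairwise_def)
    then have "R \<subseteq> snd ` p" by blast
    then show ?thesis using fin_dom p B(1) by (meson finite_subset subsetD)
  qed
  \<comment> \<open>The enumeration decides which points of two conditions correspond. It may repeat
    entries; this is harmless, since cross colours are used only for indices with different
    entries.\<close>
  have "\<exists>xs. set xs = snd ` p - R" if "p \<in> B" for p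
    using fin_dom[of p] that B(1) by (intro finite_list) auto
  then obtain x where x: "\<And>p. p \<in> B \<Longrightarrow> set (x p) = snd ` p - R"
    by metis
  \<comment> \<open>First the label sets of the points outside the root, then the trace on the root.
    Both consist of finite sets over countable sets, so one value of \<open>?g\<close> is shared by
    uncountably many conditions.\<close>
  let ?g = "\<lambda>p. (map (\<lambda>\<alpha>. {l. (l, \<alpha>) \<in> p}) (x p), {u \<in> p. snd u \<in> R})"
  have "countable (?g ` B)"
  proof (rule countable_subset)
    show "?g ` B \<subseteq> lists {t. finite t} \<times> {u. u \<subseteq> UNIV \<times> R \<and> finite u}"
    proof (rule image_subsetI)
      fix p assume "p \<in> B"
      then have "finite p" using B(1) fin by blast
      then have "finite {l. (l, \<alpha>) \<in> p}" for \<alpha>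
        by (auto intro!: finite_subset[of "{l. (l, \<alpha>) \<in> p}" "fst ` p"] simp: image_iff)
           (metis fst_conv)
      with \<open>finite p\<close>
      show "?g p \<in> lists {t. finite t} \<times> {u. u \<subseteq> UNIV \<times> R \<and> finite u}"
        by (auto simp: in_lists_conv_set)
    qed
    have "countable {t :: (nat \<times> nat \<times> bool) set. t \<subseteq> UNIV \<and> finite t}"
      using countable_Collect_finite_subset[of "UNIV :: (nat \<times> nat \<times> bool) set"]
      by (simp add: conj_commute)
    moreover have "countable {u. u \<subseteq> (UNIV :: (nat \<times> nat \<times> bool) set) \<times> R \<and> finite u}"
      using countable_Collect_finite_subset[of "(UNIV :: (nat \<times> nat \<times> bool) set) \<times> R"] \<open>finite R\<close>
      by (simp add: conj_commute countable_finite)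
    ultimately show "countable (lists {t :: (nat \<times> nat \<times> bool) set. finite t} \<times>
        {u. u \<subseteq> (UNIV :: (nat \<times> nat \<times> bool) set) \<times> R \<and> finite u})"
      by auto
  qed
  from uncountable_fibre[OF B(2) this] obtain y where y: "uncountable {p \<in> B. ?g p = y}" .
  obtain ts r where tsr: "y = (ts, r)" by (cases y)
  define C where "C = {p \<in> B. ?g p = y}"
  have C: "uncountable C" "C \<subseteq> B" "\<And>p. p \<in> C \<Longrightarrow> ?g p = (ts, r)"
    using y by (simp_all add: C_def tsr)
  have len: "length (x p) = length ts" if "p \<in> C" for p
  proof -
    have "map (\<lambda>\<alpha>. {l. (l, \<alpha>) \<in> p}) (x p) = ts"
      using C(3)[OF that] by simp
    then show ?thesis by auto
  qed
  have disj: "set (x p) \<inter> set (x q) = {}" if "p \<in> C" "q \<in> C" "p \<noteq> q" for p q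
  proof -
    have "p \<in> B" "q \<in> B"
      using C(2) that by blast+
    then have "snd ` p \<inter> snd ` q = R"
      using B(3) that(3) by (simp add: pairwise_def)
    then show ?thesis
      using x[OF \<open>p \<in> B\<close>] x[OF \<open>q \<in> B\<close>] by blast
  qed
  \<comment> \<open>With no points outside the root, every member of \<open>C\<close> would equal
    its trace \<open>r\<close>. Nonempty tuples with disjoint entry sets are distinct, which makes
    \<open>x\<close> injective on \<open>C\<close> and keeps the family of tuples
    uncountable.\<close>
  have "ts \<noteq> []"
  proof
    assume "ts = []"
    have "p = r" if "p \<in> C" for p
    proof -
      have "set (x p) = {}" using len[OF that] \<open>ts = []\<close> by simp
      moreover have "set (x p) = snd ` p - R"
        using C(2) that by (intro x) (rule subsetD)
      ultimately have "snd ` p \<subseteq> R" by simp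
      then have "{u \<in> p. snd u \<in> R} = p" by blast
      then show ?thesis using C(3)[OF that] by simp
    qed
    then have "C \<subseteq> {r}" by blast
    then show False using C(1) by (meson countable_finite finite.emptyI finite.insertI countable_subset)
  qed
  have "inj_on x C"
  proof (rule inj_onI, rule ccontr)
    fix p q assume "p \<in> C" "q \<in> C" "x p = x q" "p \<noteq> q"
    then have "x p = []" using disj[of p q] by simp
    then show False using len[OF \<open>p \<in> C\<close>] \<open>ts \<noteq> []\<close> by simp
  qed
  then have "uncountable (x ` C)"
    using C(1) countable_image_inj_on by blast
  moreover have "length xs = length ts" if "xs \<in> x ` C" for xs
    using that len by (elim imageE) simp
  moreover have "pairwise (\<lambda>xs ys. set xs \<inter> set ys = {}) (x ` C)"
  proof (rule pairwiseI)
    fix xs ys assume "xs \<in> x ` C" "ys \<in> x ` C" "xs \<noteq> ys"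
    then obtain p q where "p \<in> C" "q \<in> C" "xs = x p" "ys = x q" "p \<noteq> q"
      by (metis imageE)
    then show "set xs \<inter> set ys = {}" using disj by simp
  qed
  ultimately obtain xs ys where xsys: "xs \<in> x ` C" "ys \<in> x ` C" "xs \<noteq> ys" "alike c xs ys"
    by (rule rectangular_uncountable[OF rect])
  from xsys(1) obtain p where p: "p \<in> C" "xs = x p" by (elim imageE)
  from xsys(2) obtain q where q: "q \<in> C" "ys = x q" by (elim imageE)
  have pq: "p \<in> C" "q \<in> C" "p \<noteq> q" "alike c (x p) (x q)"
    using p q xsys(3,4) by auto
  then have inB: "p \<in> B" "q \<in> B"
    using C(2) by (simp_all add: subsetD)
  then have inA: "p \<in> A" "q \<in> A"
    using B(1) by (simp_all add: subsetD)
  then have inP: "p \<in> ?P" "q \<in> ?P"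
    using A by (simp_all add: subsetD)
  have "p \<union> q \<in> ?P"
  proof (rule rect_conditions_Un[OF inP _ _ _ _ pq(4)])
    show "set (x p) = snd ` p - R" "set (x q) = snd ` q - R"
      by (rule x[OF inB(1)], rule x[OF inB(2)])
    show "map (\<lambda>\<alpha>. {l. (l, \<alpha>) \<in> p}) (x p) = map (\<lambda>\<alpha>. {l. (l, \<alpha>) \<in> q}) (x q)"
      "{u \<in> p. snd u \<in> R} = {u \<in> q. snd u \<in> R}"
      using C(3)[OF pq(1)] C(3)[OF pq(2)] by simp_all
  qed
  then have "compatible ?P (ext_order ?P) p q"
    using inP unfolding compatible_def ext_order_def by blast
  then show False
    using pairwiseD[OF incomp inA pq(3)] by simp
qed

section \<open>Density and the generic rectangles\<close>

text \<open>A finite condition mentions finitely many indices, so some \<open>m\<close> is fresh for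
  every colour. The rectangle of colour \<open>c \<alpha> \<beta>\<close> and index \<open>m\<close>
  then contains only the two added points, one on each side.\<close>

lemma dense_rect_conditions:
  assumes "\<alpha> \<noteq> \<beta>"
  shows "dense_in (rect_conditions c) (ext_order (rect_conditions c))
    {p \<in> rect_conditions c. \<exists>k m. ((k, m, True), \<alpha>) \<in> p \<and> ((k, m, False), \<beta>) \<in> p}"
  unfolding dense_in_def
proof (intro conjI ballI)
  fix p assume p: "p \<in> rect_conditions c"
  then have "finite ((\<lambda>u. fst (snd (fst u))) ` p)"
    by (simp add: rect_conditions_def)
  then obtain m where "m \<notin> (\<lambda>u. fst (snd (fst u))) ` p"
    using ex_new_if_finite infinite_UNIV_nat by blast
  then have m: "((k, m, b), \<gamma>) \<notin> p" for k b \<gamma>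
    by force
  define q where "q = {((c \<alpha> \<beta>, m, True), \<alpha>), ((c \<alpha> \<beta>, m, False), \<beta>)} \<union> p"
  have "q \<in> rect_conditions c"
    using p m assms unfolding rect_conditions_def q_def by auto
  moreover have "p \<subseteq> q" "((c \<alpha> \<beta>, m, True), \<alpha>) \<in> q" "((c \<alpha> \<beta>, m, False), \<beta>) \<in> q"
    by (auto simp: q_def)
  ultimately show "\<exists>d\<in>{p \<in> rect_conditions c. \<exists>k m. ((k, m, True), \<alpha>) \<in> p \<and> ((k, m, False), \<beta>) \<in> p}.
      (d, p) \<in> ext_order (rect_conditions c)"
    using p unfolding ext_order_def by blast
qed blast

theorem mainTheorem17:
  fixes c :: "omega1 \<Rightarrow> omega1 \<Rightarrow> 'k" and K :: "'k set"
  assumes "(UNIV :: omega1 set) \<lesssim> (UNIV :: 'p set)"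
    and "MA_omega1 TYPE('p)"
    and "countable K" and "\<forall>\<alpha> \<beta>. c \<alpha> \<beta> \<in> K"
    and "rectangular c"
  shows "\<exists>I J :: nat \<Rightarrow> omega1 set.
           (\<forall>n. \<exists>k. \<forall>\<alpha>\<in>I n. \<forall>\<beta>\<in>J n. c \<alpha> \<beta> = k) \<and>
           (\<Union>n. I n \<times> J n) = {(\<alpha>, \<beta>). \<alpha> \<noteq> \<beta>}"
proof -
  \<comment> \<open>Colours become natural numbers so that the labels form a countable type. The
    code is injective on \<open>K\<close>, so \<open>from_nat_into K\<close> recovers
    \<open>c\<close> from \<open>d\<close> at the end.\<close>
  define d where "d = (\<lambda>\<alpha> \<beta>. to_nat_on K (c \<alpha> \<beta>))"
  let ?P = "rect_conditions d"
  define E where "E = (\<lambda>(\<alpha>, \<beta>).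
    {p \<in> ?P. \<exists>k m. ((k, m, True), \<alpha>) \<in> p \<and> ((k, m, False), \<beta>) \<in> p})"
  have "?P \<lesssim> (UNIV :: omega1 set)"
  proof (rule lepoll_trans[OF subset_imp_lepoll finite_labelled_subsets_lepoll_omega1])
    show "?P \<subseteq> {p. finite p}"
      unfolding rect_conditions_def by blast
  qed
  moreover have "{} \<in> ?P"
    by (simp add: rect_conditions_def)
  moreover have "ccc ?P (ext_order ?P)"
    unfolding d_def by (rule ccc_rect_conditions[OF rectangular_comp[OF assms(5)]])
  moreover have "E ` {(\<alpha>, \<beta>). \<alpha> \<noteq> \<beta>} \<lesssim> (UNIV :: omega1 set)"
    by (rule lepoll_trans[OF image_lepoll
          lepoll_trans[OF subset_imp_lepoll[OF subset_UNIV] omega1_times_omega1_lepoll]])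
  moreover have "dense_in ?P (ext_order ?P) D" if "D \<in> E ` {(\<alpha>, \<beta>). \<alpha> \<noteq> \<beta>}" for D
    using that dense_rect_conditions by (auto simp: E_def)
  ultimately obtain G where G: "filter_in ?P (ext_order ?P) G"
    and meets: "\<And>D. D \<in> E ` {(\<alpha>, \<beta>). \<alpha> \<noteq> \<beta>} \<Longrightarrow> G \<inter> D \<noteq> {}"
    using MA_omega1_transfer[OF assms(1,2) _ _ partial_order_on_ext_order] by blast
  \<comment> \<open>\<open>n\<close> codes a colour together with an index, and \<open>b\<close>
    selects the side; the filter determines which points have been put there.\<close>
  define S where "S b n = {\<alpha>. \<exists>p\<in>G. ((fst (prod_decode n), snd (prod_decode n), b), \<alpha>) \<in> p}"
    for b n
  \<comment> \<open>The two labels may come from different elements of \<open>G\<close>. A common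
    extension carries both, and being a condition it separates the points and fixes their
    colour.\<close>
  have sound: "\<alpha> \<noteq> \<beta> \<and> d \<alpha> \<beta> = fst (prod_decode n)" if S: "\<alpha> \<in> S True n" "\<beta> \<in> S False n" for n \<alpha> \<beta>
  proof -
    obtain p q where pq: "p \<in> G" "((fst (prod_decode n), snd (prod_decode n), True), \<alpha>) \<in> p"
      "q \<in> G" "((fst (prod_decode n), snd (prod_decode n), False), \<beta>) \<in> q"
      using S by (auto simp: S_def)
    then obtain s where "(s, p) \<in> ext_order ?P" "(s, q) \<in> ext_order ?P"
      using G unfolding filter_in_def by blast
    then have "s \<in> ?P" "p \<subseteq> s" "q \<subseteq> s"
      by (auto simp: ext_order_def)
    with pq show ?thesis
      unfolding rect_conditions_def by blast
  qed
  have colour: "c \<alpha> \<beta> = from_nat_into K (d \<alpha> \<beta>)" for \<alpha> \<beta>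
    using assms(3,4) by (simp add: d_def)
  have cover: "\<exists>n. \<alpha> \<in> S True n \<and> \<beta> \<in> S False n" if "\<alpha> \<noteq> \<beta>" for \<alpha> \<beta>
  proof -
    have "G \<inter> E (\<alpha>, \<beta>) \<noteq> {}"
      using that by (intro meets) auto
    then obtain p k m where "p \<in> G" "((k, m, True), \<alpha>) \<in> p" "((k, m, False), \<beta>) \<in> p"
      by (auto simp: E_def)
    then have "\<alpha> \<in> S True (prod_encode (k, m)) \<and> \<beta> \<in> S False (prod_encode (k, m))"
      by (auto simp: S_def)
    then show ?thesis ..
  qed
  show ?thesis
  proof (intro exI conjI allI)
    fix n
    show "\<forall>\<alpha>\<in>S True n. \<forall>\<beta>\<in>S False n. c \<alpha> \<beta> = from_nat_into K (fst (prod_decode n))"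
      using sound colour by metis
  next
    show "(\<Union>n. S True n \<times> S False n) = {(\<alpha>, \<beta>). \<alpha> \<noteq> \<beta>}"
      using sound by (auto dest: cover)
  qed
qed

end
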